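(* Let $V$ be a finite nonempty set, $n\in\mathbb{R}$, and let $\mathscr{C}$ be a family of supermodular functions $\mu\colon 2^V\to\mathbb{R}$ of range $\mu(V)=n$. If $\mathscr{C}$ is separated and closed, then the collection of polytopes $\mathbf{P}_\mu$, $\mu\in\mathscr{C}$, gives a tiling of $\mathbf{P}_{\mathscr{C}}:=\bigcup_{\mu\in\mathscr{C}}\mathbf{P}_\mu$.
   Context: A function $\mu\colon 2^V\to\mathbb{R}$ is supermodular if $\mu(\emptyset)=0$ and $\mu(I_1)+\mu(I_2)\le\mu(I_1\cup I_2)+\mu(I_1\cap I_2)$ for all $I_1,I_2\subseteq V$. Its range is $\mu(V)$. Its adjoint is $\mu^*(I):=\mu(V)-\mu(V\setminus I)$. For $q\in\mathbb{R}^V$ and $I\subseteq V$ put $q(I)=\sum_{v\in I}q(v)$. The base polytope of $\mu$ is $\mathbf{P}_\mu:=\{q\in\mathbb{R}^V:\mu(I)\le q(I)\le\mu^*(I)\ \forall I\subseteq V\}$. Splittings: for an ordered partition $\pi=(\pi_1,\dots,\pi_s)$ of $V$ (pairwise disjoint subsets with union $V$), put $F_0=\emptyset$, $F_i=\pi_1\cup\dots\cup\pi_i$, and $$\mu_\pi(I):=\sum_{i=1}^s\Big(\mu\big((I\cap F_i)\cup F_{i-1}\big)-\mu(F_{i-1})\Big).$$ This is a supermodular function of the same range as $\mu$, called a splitting of $\mu$. A bipartition of $V$ is an ordered partition $\pi=(I,J)$ into two nonempty parts; then $\mu_\pi(S)=\mu(S\cup I)-\mu(I)+\mu(S\cap I)$.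 For $\mu,\nu$ supermodular of range $n$, a bipartition $\pi=(I,J)$ is a separation for $(\mu,\nu)$ if $\mu(I)+\nu(J)\ge n$. It is a nontrivial separation if moreover either the inequality is strict, or $\mu_\pi\ne\mu$, or $\nu_{\pi^c}\neq\nu$, where $\pi^c=(J,I)$ (one has $\nu_{\pi^c}=\nu$ if and only if $\nu_\pi=\nu$). The existence of a nontrivial separation does not depend on the order of the pair. The family $\mathscr{C}$ is separated if any two distinct elements of $\mathscr{C}$ admit a nontrivial separation. It is closed if each splitting of each element of $\mathscr{C}$ is in $\mathscr{C}$. A collection of polytopes gives a tiling of a set $S$ if their union is $S$ and any two of them are either disjoint or intersect in a common face. *)

theory Defs
  imports "HOL-Analysis.Analysis"
begin

text \<open>
  The finite nonempty ground set \<open>V\<close> is the universe of a type \<open>'v\<close> of class \<open>finite\<close>, so that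
  \<open>\<real>\<^sup>V\<close> is \<open>real ^ 'v\<close>.
\<close>

definition supermodular :: "('v set \<Rightarrow> real) \<Rightarrow> bool" where
  "supermodular \<mu> \<longleftrightarrow>
     \<mu> {} = 0 \<and> (\<forall>I\<^sub>1 I\<^sub>2. \<mu> I\<^sub>1 + \<mu> I\<^sub>2 \<le> \<mu> (I\<^sub>1 \<union> I\<^sub>2) + \<mu> (I\<^sub>1 \<inter> I\<^sub>2))"

definition sm_range :: "('v set \<Rightarrow> real) \<Rightarrow> real" where
  "sm_range \<mu> = \<mu> UNIV"

definition sm_adjoint :: "('v set \<Rightarrow> real) \<Rightarrow> 'v set \<Rightarrow> real" where
  "sm_adjoint \<mu> I = \<mu> UNIV - \<mu> (UNIV - I)"

definition base_polytope :: "('v::finite set \<Rightarrow> real) \<Rightarrow> (real ^ 'v) set" where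
  "base_polytope \<mu> =
     {q. \<forall>I. \<mu> I \<le> (\<Sum>v\<in>I. q $ v) \<and> (\<Sum>v\<in>I. q $ v) \<le> sm_adjoint \<mu> I}"

text \<open>
  An ordered partition \<open>(\<pi>\<^sub>1, \<dots>, \<pi>\<^sub>s)\<close> is a list of sets. Empty parts are allowed; only bipartitions
  are required to have nonempty parts.
\<close>

definition ordered_partition :: "'v set list \<Rightarrow> bool" where
  "ordered_partition \<pi> \<longleftrightarrow>
     disjoint_family_on (\<lambda>i. \<pi> ! i) {..<length \<pi>} \<and> \<Union> (set \<pi>) = UNIV"

definition flag :: "'v set list \<Rightarrow> nat \<Rightarrow> 'v set" where
  "flag \<pi> i = \<Union> (set (take i \<pi>))"

text \<open>The summation index is shifted by one: \<open>i < s\<close> here is \<open>i + 1\<close> in \<open>F\<^sub>1, \<dots>, F\<^sub>s\<close>.\<close>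

definition splitting :: "('v set \<Rightarrow> real) \<Rightarrow> 'v set list \<Rightarrow> 'v set \<Rightarrow> real" where
  "splitting \<mu> \<pi> I =
     (\<Sum>i<length \<pi>. \<mu> ((I \<inter> flag \<pi> (Suc i)) \<union> flag \<pi> i) - \<mu> (flag \<pi> i))"

definition bipartition :: "'v set \<Rightarrow> 'v set \<Rightarrow> bool" where
  "bipartition I J \<longleftrightarrow> ordered_partition [I, J] \<and> I \<noteq> {} \<and> J \<noteq> {}"

lemma splitting_bipartition:
  assumes "supermodular \<mu>" and "bipartition I J"
  shows "splitting \<mu> [I, J] S = \<mu> (S \<union> I) - \<mu> I + \<mu> (S \<inter> I)"
  using assms
  by (simp add: splitting_def flag_def supermodular_def bipartition_def ordered_partition_def)

text \<open>The parameter \<open>n\<close> below is the common range of \<open>\<mu>\<close> and \<open>\<nu>\<close>.\<close>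

definition separation ::
    "real \<Rightarrow> ('v set \<Rightarrow> real) \<Rightarrow> ('v set \<Rightarrow> real) \<Rightarrow> 'v set \<Rightarrow> 'v set \<Rightarrow> bool" where
  "separation n \<mu> \<nu> I J \<longleftrightarrow> bipartition I J \<and> \<mu> I + \<nu> J \<ge> n"

definition nontrivial_separation ::
    "real \<Rightarrow> ('v set \<Rightarrow> real) \<Rightarrow> ('v set \<Rightarrow> real) \<Rightarrow> 'v set \<Rightarrow> 'v set \<Rightarrow> bool" where
  "nontrivial_separation n \<mu> \<nu> I J \<longleftrightarrow>
     separation n \<mu> \<nu> I J \<and>
     (\<mu> I + \<nu> J > n \<or> splitting \<mu> [I, J] \<noteq> \<mu> \<or> splitting \<nu> [J, I] \<noteq> \<nu>)"

definition separated_family :: "real \<Rightarrow> ('v set \<Rightarrow> real) set \<Rightarrow> bool" where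
  "separated_family n \<C> \<longleftrightarrow>
     (\<forall>\<mu>\<in>\<C>. \<forall>\<nu>\<in>\<C>. \<mu> \<noteq> \<nu> \<longrightarrow> (\<exists>I J. nontrivial_separation n \<mu> \<nu> I J))"

definition closed_family :: "('v set \<Rightarrow> real) set \<Rightarrow> bool" where
  "closed_family \<C> \<longleftrightarrow> (\<forall>\<mu>\<in>\<C>. \<forall>\<pi>. ordered_partition \<pi> \<longrightarrow> splitting \<mu> \<pi> \<in> \<C>)"

text \<open>
  No finiteness of the collection is required. The empty set counts as a face for \<open>face_of\<close>,
  so the disjointness disjunct is redundant for convex \<open>P\<close> and \<open>Q\<close>.
\<close>

definition tiling :: "'a::euclidean_space set set \<Rightarrow> 'a set \<Rightarrow> bool" where
  "tiling \<P> S \<longleftrightarrow>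
     (\<forall>P\<in>\<P>. polytope P) \<and> \<Union> \<P> = S \<and>
     (\<forall>P\<in>\<P>. \<forall>Q\<in>\<P>. P \<noteq> Q \<longrightarrow>
        P \<inter> Q = {} \<or> (P \<inter> Q face_of P \<and> P \<inter> Q face_of Q))"

end

theory Submission
  imports Defs
begin

text \<open>
  Let \<open>\<mu>\<close> and \<open>\<nu>\<close> be members of the family and let \<open>(I, J)\<close> be a nontrivial separation of them.
  A common point \<open>q\<close> of the two base polytopes has total mass \<open>n\<close>, so
  \<open>n \<le> \<mu> I + \<nu> J \<le> q(I) + q(J) = n\<close>. A strict separation therefore makes the polytopes
  disjoint. A tight one forces \<open>q(I) = \<mu> I\<close> and \<open>q(J) = \<nu> J\<close>. These equations cut out a face of each
  polytope, and each face is again a base polytope, namely that of the splitting of \<open>\<mu>\<close> along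
  \<open>(I, J)\<close>, respectively of \<open>\<nu>\<close> along \<open>(J, I)\<close> (lemma \<open>base_polytope_splitting\<close>). Both splittings
  lie in the family by closedness, so the pair \<open>(\<mu>, \<nu>)\<close> may be replaced by the pair of splittings
  without changing the intersection. Since a face of a face is a face, it remains to see that this
  replacement stops.

  Geometrically it stops because a proper face has smaller dimension. The proof uses a
  combinatorial substitute that needs no vertices of the polytope: the sets \<open>A\<close> with
  \<open>\<mu> A + \<mu> (-A) = \<mu> UNIV\<close>, called separators. They are the sets on which \<open>q(A)\<close> is constant on the
  polytope, so passing to a splitting preserves them. The set \<open>I\<close> becomes a separator of the
  splitting along \<open>(I, -I)\<close>; if it already was one, the splitting is \<open>\<mu>\<close> itself. Hence every
  splitting that changes \<open>\<mu>\<close> gains a separator, and there are finitely many sets.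
\<close>

section \<open>Splittings along bipartitions\<close>

lemma bipartition_iff: "bipartition I J \<longleftrightarrow> J = - I \<and> I \<noteq> {} \<and> I \<noteq> UNIV"
  by (auto simp: bipartition_def ordered_partition_def disjoint_family_on_def lessThan_Suc)

lemma splitting_eq:
  assumes "supermodular \<mu>"
  shows "splitting \<mu> [I, - I] S = \<mu> (S \<union> I) - \<mu> I + \<mu> (S \<inter> I)"
  using assms by (simp add: splitting_def flag_def supermodular_def)

lemma supermodularD:
  assumes "supermodular \<mu>"
  shows "\<mu> A + \<mu> B \<le> \<mu> (A \<union> B) + \<mu> (A \<inter> B)"
  using assms unfolding supermodular_def by blast

lemma supermodular_empty: "supermodular \<mu> \<Longrightarrow> \<mu> {} = 0"
  unfolding supermodular_def by blast

lemma splitting_ge: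
  assumes "supermodular \<mu>"
  shows "\<mu> S \<le> splitting \<mu> [I, - I] S"
  using splitting_eq[OF assms, of I S] supermodularD[OF assms, of S I] by simp

section \<open>Faces of base polytopes\<close>

text \<open>
  The upper bounds \<open>q(I) \<le> sm_adjoint \<mu> I\<close> are the lower bounds for the complements, rewritten
  with the equation for the total mass.
\<close>

lemma mem_base_polytope_iff:
  fixes \<mu> :: "'v::finite set \<Rightarrow> real"
  assumes "supermodular \<mu>"
  shows "q \<in> base_polytope \<mu> \<longleftrightarrow>
    (\<forall>I. \<mu> I \<le> (\<Sum>v\<in>I. q $ v)) \<and> (\<Sum>v\<in>UNIV. q $ v) = \<mu> UNIV"
proof -
  have compl: "(\<Sum>v\<in>UNIV. q $ v) = (\<Sum>v\<in>I. q $ v) + (\<Sum>v\<in>UNIV - I. q $ v)" for I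
    using sum.subset_diff[of I UNIV "\<lambda>v. q $ v"] by simp
  show ?thesis
  proof
    assume q: "q \<in> base_polytope \<mu>"
    then have "\<mu> UNIV \<le> (\<Sum>v\<in>UNIV. q $ v)" "(\<Sum>v\<in>UNIV. q $ v) \<le> sm_adjoint \<mu> UNIV"
      unfolding base_polytope_def by blast+
    then have "(\<Sum>v\<in>UNIV. q $ v) = \<mu> UNIV"
      using supermodular_empty[OF assms] by (simp add: sm_adjoint_def)
    with q show "(\<forall>I. \<mu> I \<le> (\<Sum>v\<in>I. q $ v)) \<and> (\<Sum>v\<in>UNIV. q $ v) = \<mu> UNIV"
      unfolding base_polytope_def by blast
  next
    assume *: "(\<forall>I. \<mu> I \<le> (\<Sum>v\<in>I. q $ v)) \<and> (\<Sum>v\<in>UNIV. q $ v) = \<mu> UNIV"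
    have "(\<Sum>v\<in>I. q $ v) \<le> sm_adjoint \<mu> I" for I
    proof -
      have "\<mu> (UNIV - I) \<le> (\<Sum>v\<in>UNIV - I. q $ v)" using * by blast
      then show ?thesis using compl[of I] * by (simp add: sm_adjoint_def)
    qed
    with * show "q \<in> base_polytope \<mu>" by (auto simp: base_polytope_def)
  qed
qed

lemma inner_indicator_vec:
  fixes q :: "real ^ 'v::finite"
  shows "(\<chi> v. if v \<in> I then 1 else 0) \<bullet> q = (\<Sum>v\<in>I. q $ v)"
  by (simp add: inner_vec_def if_distrib[of "\<lambda>c. c * _"] sum.If_cases cong: if_cong)

lemma polytope_base_polytope:
  fixes \<mu> :: "'v::finite set \<Rightarrow> real"
  shows "polytope (base_polytope \<mu>)"
proof -
  define a :: "'v set \<Rightarrow> real ^ 'v" where "a I = (\<chi> v. if v \<in> I then 1 else 0)" for I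
  have a: "a I \<bullet> q = (\<Sum>v\<in>I. q $ v)" for I q
    unfolding a_def by (rule inner_indicator_vec)
  have "base_polytope \<mu> =
      \<Inter> (range (\<lambda>I. {q. a I \<bullet> q \<ge> \<mu> I} \<inter> {q. a I \<bullet> q \<le> sm_adjoint \<mu> I}))"
    by (auto simp: base_polytope_def a)
  moreover have "polyhedron \<dots>"
    by (rule polyhedron_Inter)
      (auto intro!: polyhedron_Int polyhedron_halfspace_ge polyhedron_halfspace_le)
  moreover have "bounded (base_polytope \<mu>)"
  proof (rule bounded_subset[OF bounded_cbox])
    \<comment> \<open>The constraints for singletons confine every coordinate to an interval.\<close>
    show "base_polytope \<mu> \<subseteq> cbox (\<chi> v. \<mu> {v}) (\<chi> v. sm_adjoint \<mu> {v})"
    proof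
      fix q assume q: "q \<in> base_polytope \<mu>"
      have "\<mu> {v} \<le> q $ v \<and> q $ v \<le> sm_adjoint \<mu> {v}" for v
      proof -
        have "\<mu> {v} \<le> (\<Sum>w\<in>{v}. q $ w) \<and> (\<Sum>w\<in>{v}. q $ w) \<le> sm_adjoint \<mu> {v}"
          using q unfolding base_polytope_def by blast
        then show ?thesis by simp
      qed
      then show "q \<in> cbox (\<chi> v. \<mu> {v}) (\<chi> v. sm_adjoint \<mu> {v})"
        by (simp add: mem_box_cart)
    qed
  qed
  ultimately show ?thesis by (simp add: polytope_eq_bounded_polyhedron)
qed

text \<open>
  On the hyperplane \<open>q(I) = \<mu> I\<close> the lower bounds for \<open>S \<union> I\<close> and \<open>S \<inter> I\<close> add up to the bound that
  the splitting imposes on \<open>S\<close>. Conversely the splitting only sharpens the bounds of \<open>\<mu>\<close>, and its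
  bounds for \<open>I\<close> and \<open>-I\<close> add up to the total mass, so both are attained.
\<close>

lemma base_polytope_splitting:
  fixes \<mu> :: "'v::finite set \<Rightarrow> real"
  assumes "supermodular \<mu>" and "supermodular (splitting \<mu> [I, - I])"
  shows "base_polytope (splitting \<mu> [I, - I]) = base_polytope \<mu> \<inter> {q. (\<Sum>v\<in>I. q $ v) = \<mu> I}"
proof -
  let ?\<mu>' = "splitting \<mu> [I, - I]"
  note eq = splitting_eq[OF assms(1), of I]
  note empty = supermodular_empty[OF assms(1)]
  have univ: "?\<mu>' UNIV = \<mu> UNIV" by (simp add: eq)
  show ?thesis
  proof (intro equalityI subsetI)
    fix q assume "q \<in> base_polytope ?\<mu>'"
    then have lower: "\<And>S. ?\<mu>' S \<le> (\<Sum>v\<in>S. q $ v)" and total: "(\<Sum>v\<in>UNIV. q $ v) = \<mu> UNIV"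
      using univ by (auto simp: mem_base_polytope_iff[OF assms(2)])
    have "\<mu> S \<le> (\<Sum>v\<in>S. q $ v)" for S
      using splitting_ge[OF assms(1)] lower by (rule order_trans)
    moreover have "(\<Sum>v\<in>I. q $ v) = \<mu> I"
    proof -
      have "(\<Sum>v\<in>UNIV. q $ v) = (\<Sum>v\<in>I. q $ v) + (\<Sum>v\<in>- I. q $ v)"
        using sum.subset_diff[of I UNIV "\<lambda>v. q $ v"] by (simp add: Compl_eq_Diff_UNIV)
      moreover have "?\<mu>' I = \<mu> I" "?\<mu>' (- I) = \<mu> UNIV - \<mu> I"
        by (simp_all add: eq empty)
      ultimately show ?thesis using lower[of I] lower[of "- I"] total by linarith
    qed
    ultimately show "q \<in> base_polytope \<mu> \<inter> {q. (\<Sum>v\<in>I. q $ v) = \<mu> I}"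
      using total by (simp add: mem_base_polytope_iff[OF assms(1)])
  next
    fix q assume "q \<in> base_polytope \<mu> \<inter> {q. (\<Sum>v\<in>I. q $ v) = \<mu> I}"
    then have lower: "\<And>S. \<mu> S \<le> (\<Sum>v\<in>S. q $ v)" and total: "(\<Sum>v\<in>UNIV. q $ v) = \<mu> UNIV"
      and tight: "(\<Sum>v\<in>I. q $ v) = \<mu> I"
      by (auto simp: mem_base_polytope_iff[OF assms(1)])
    have "?\<mu>' S \<le> (\<Sum>v\<in>S. q $ v)" for S
      using sum.union_inter[of S I "\<lambda>v. q $ v"] lower[of "S \<union> I"] lower[of "S \<inter> I"] tight eq[of S]
      by simp
    then show "q \<in> base_polytope ?\<mu>'"
      using total univ by (simp add: mem_base_polytope_iff[OF assms(2)])
  qed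
qed

lemma base_polytope_splitting_face:
  fixes \<mu> :: "'v::finite set \<Rightarrow> real"
  assumes "supermodular \<mu>" and "supermodular (splitting \<mu> [I, - I])"
  shows "base_polytope (splitting \<mu> [I, - I]) face_of base_polytope \<mu>"
proof -
  let ?a = "\<chi> v. if v \<in> I then 1 else (0::real)"
  have "base_polytope \<mu> \<inter> {q. ?a \<bullet> q = \<mu> I} face_of base_polytope \<mu>"
  proof (rule face_of_Int_supporting_hyperplane_ge)
    show "convex (base_polytope \<mu>)"
      by (rule polytope_imp_convex[OF polytope_base_polytope])
    show "?a \<bullet> q \<ge> \<mu> I" if "q \<in> base_polytope \<mu>" for q
      using that by (simp add: inner_indicator_vec mem_base_polytope_iff[OF assms(1)])
  qed
  then show ?thesis
    by (simp add: inner_indicator_vec base_polytope_splitting[OF assms])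
qed

section \<open>Splittings gain separators\<close>

text \<open>
  The complement of the set of separators is taken so that its cardinality decreases along
  splittings and can serve as an induction measure.
\<close>

definition nonseparators :: "('v set \<Rightarrow> real) \<Rightarrow> 'v set set" where
  "nonseparators \<mu> = {A. \<mu> A + \<mu> (- A) \<noteq> \<mu> UNIV}"

text \<open>
  Supermodularity applied to \<open>S \<inter> A\<close> and \<open>S - A\<close> bounds \<open>\<mu> S\<close> from below; applied to the pairs
  \<open>S, A\<close> and \<open>S \<union> A, -A\<close> it bounds \<open>\<mu> S\<close> from above. For a separator the two bounds agree.
\<close>

lemma separator_decompose:
  assumes "supermodular \<mu>" and "A \<notin> nonseparators \<mu>"
  shows "\<mu> S = \<mu> (S \<inter> A) + \<mu> (S - A)"
    and "\<mu> (S \<union> A) = \<mu> A + \<mu> (S - A)"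
proof -
  have sets: "S \<inter> A \<union> (S - A) = S" "S \<inter> A \<inter> (S - A) = {}"
    "S \<union> A \<union> - A = UNIV" "(S \<union> A) \<inter> - A = S - A"
    "A \<union> (S - A) = S \<union> A" "A \<inter> (S - A) = {}"
    by auto
  note inst = supermodularD[OF assms(1), of "S \<inter> A" "S - A"] supermodularD[OF assms(1), of S A]
    supermodularD[OF assms(1), of "S \<union> A" "- A"] supermodularD[OF assms(1), of A "S - A"]
  have "\<mu> A + \<mu> (- A) = \<mu> UNIV" using assms(2) by (simp add: nonseparators_def)
  then show "\<mu> S = \<mu> (S \<inter> A) + \<mu> (S - A)" "\<mu> (S \<union> A) = \<mu> A + \<mu> (S - A)"
    using inst unfolding sets supermodular_empty[OF assms(1)] by linarith+
qed

text \<open>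
  If \<open>A\<close> is a separator of \<open>\<mu>\<close>, then every value of \<open>\<mu>\<close> is the sum of its values on the parts
  inside and outside \<open>A\<close>. Expanding the splitting at \<open>A\<close> and \<open>-A\<close> in this way, the contributions
  of \<open>I \<inter> A\<close> and \<open>I - A\<close> cancel against \<open>2 * \<mu> I\<close>.
\<close>

lemma nonseparators_splitting_subset:
  assumes "supermodular \<mu>"
  shows "nonseparators (splitting \<mu> [I, - I]) \<subseteq> nonseparators \<mu>"
proof
  fix A assume A: "A \<in> nonseparators (splitting \<mu> [I, - I])"
  show "A \<in> nonseparators \<mu>"
  proof (rule ccontr)
    assume sep: "A \<notin> nonseparators \<mu>"
    then have sep': "- A \<notin> nonseparators \<mu>" by (simp add: nonseparators_def add.commute)
    have "\<mu> A + \<mu> (- A) = \<mu> UNIV" using sep by (simp add: nonseparators_def)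
    moreover have "\<mu> (A \<union> I) = \<mu> A + \<mu> (I - A)"
      using separator_decompose(2)[OF assms sep, of I] by (simp add: Un_commute)
    moreover have "\<mu> (- A \<union> I) = \<mu> (- A) + \<mu> (A \<inter> I)"
      using separator_decompose(2)[OF assms sep', of I]
      by (simp add: Un_commute Int_commute Diff_eq)
    moreover have "\<mu> I = \<mu> (A \<inter> I) + \<mu> (I - A)"
      using separator_decompose(1)[OF assms sep, of I] by (simp add: Int_commute)
    moreover have "- A \<inter> I = I - A" by auto
    ultimately have "A \<notin> nonseparators (splitting \<mu> [I, - I])"
      by (simp add: nonseparators_def splitting_eq[OF assms])
    with A show False by simp
  qed
qed

lemma splitting_separator:
  assumes "supermodular \<mu>" and "I \<notin> nonseparators \<mu>"
  shows "splitting \<mu> [I, - I] = \<mu>"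
proof
  fix S
  show "splitting \<mu> [I, - I] S = \<mu> S"
    using separator_decompose[OF assms, of S] by (simp add: splitting_eq[OF assms(1)])
qed

lemma not_nonseparator_splitting:
  assumes "supermodular \<mu>"
  shows "I \<notin> nonseparators (splitting \<mu> [I, - I])"
  by (simp add: nonseparators_def splitting_eq[OF assms] supermodular_empty[OF assms])

lemma card_nonseparators_splitting:
  fixes \<mu> :: "'v::finite set \<Rightarrow> real"
  assumes "supermodular \<mu>"
  shows "card (nonseparators (splitting \<mu> [I, - I])) \<le> card (nonseparators \<mu>)"
    and "splitting \<mu> [I, - I] \<noteq> \<mu> \<Longrightarrow>
      card (nonseparators (splitting \<mu> [I, - I])) < card (nonseparators \<mu>)"
proof -
  note sub = nonseparators_splitting_subset[OF assms, of I]
  show "card (nonseparators (splitting \<mu> [I, - I])) \<le> card (nonseparators \<mu>)"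
    using sub by (simp add: card_mono)
  assume "splitting \<mu> [I, - I] \<noteq> \<mu>"
  then have "I \<in> nonseparators \<mu>" using splitting_separator[OF assms] by blast
  then have "nonseparators (splitting \<mu> [I, - I]) \<subset> nonseparators \<mu>"
    using sub not_nonseparator_splitting[OF assms, of I] by blast
  then show "card (nonseparators (splitting \<mu> [I, - I])) < card (nonseparators \<mu>)"
    by (simp add: psubset_card_mono)
qed

section \<open>Intersections in a separated closed family\<close>

lemma base_polytope_Int_separation:
  fixes \<mu> \<nu> :: "'v::finite set \<Rightarrow> real"
  assumes "supermodular \<mu>" "supermodular \<nu>"
    and "\<mu> UNIV = n" and "\<mu> I + \<nu> (- I) \<ge> n"
    and "q \<in> base_polytope \<mu>" "q \<in> base_polytope \<nu>"
  shows "(\<Sum>v\<in>I. q $ v) = \<mu> I" and "(\<Sum>v\<in>- I. q $ v) = \<nu> (- I)"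
    and "\<mu> I + \<nu> (- I) = n"
proof -
  have "(\<Sum>v\<in>UNIV. q $ v) = (\<Sum>v\<in>I. q $ v) + (\<Sum>v\<in>- I. q $ v)"
    using sum.subset_diff[of I UNIV "\<lambda>v. q $ v"] by (simp add: Compl_eq_Diff_UNIV)
  moreover have "(\<Sum>v\<in>UNIV. q $ v) = n" "\<mu> I \<le> (\<Sum>v\<in>I. q $ v)"
    using assms(3,5) by (simp_all add: mem_base_polytope_iff[OF assms(1)])
  moreover have "\<nu> (- I) \<le> (\<Sum>v\<in>- I. q $ v)"
    using assms(6) by (simp add: mem_base_polytope_iff[OF assms(2)])
  ultimately show "(\<Sum>v\<in>I. q $ v) = \<mu> I" "(\<Sum>v\<in>- I. q $ v) = \<nu> (- I)" "\<mu> I + \<nu> (- I) = n"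
    using assms(4) by linarith+
qed

text \<open>
  The pair is replaced by its splittings until the two functions coincide or their polytopes are
  disjoint. A tight nontrivial separation may leave one of the two functions unchanged, so the
  induction runs over the sum of the two numbers of nonseparators.
\<close>

lemma base_polytope_Int_face:
  fixes \<C> :: "('v::finite set \<Rightarrow> real) set"
  assumes sm: "\<And>\<mu>. \<mu> \<in> \<C> \<Longrightarrow> supermodular \<mu>"
    and range: "\<And>\<mu>. \<mu> \<in> \<C> \<Longrightarrow> sm_range \<mu> = n"
    and sep: "separated_family n \<C>" and closed: "closed_family \<C>"
    and "\<mu> \<in> \<C>" "\<nu> \<in> \<C>"
  shows "base_polytope \<mu> \<inter> base_polytope \<nu> face_of base_polytope \<mu> \<and>
    base_polytope \<mu> \<inter> base_polytope \<nu> face_of base_polytope \<nu>"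
  using assms(5,6)
proof (induction "card (nonseparators \<mu>) + card (nonseparators \<nu>)" arbitrary: \<mu> \<nu> rule: less_induct)
  case less
  note \<mu> = less.prems(1) and \<nu> = less.prems(2)
  show ?case
  proof (cases "\<mu> = \<nu>")
    case True
    then show ?thesis
      by (simp add: face_of_refl polytope_imp_convex[OF polytope_base_polytope])
  next
    case False
    with sep \<mu> \<nu> obtain I J where "nontrivial_separation n \<mu> \<nu> I J"
      unfolding separated_family_def by blast
    then have bip: "bipartition I (- I)" and ge: "\<mu> I + \<nu> (- I) \<ge> n"
      and nontriv: "\<mu> I + \<nu> (- I) > n \<or> splitting \<mu> [I, - I] \<noteq> \<mu> \<or> splitting \<nu> [- I, I] \<noteq> \<nu>"
      by (auto simp: nontrivial_separation_def separation_def bipartition_iff)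
    have univ: "\<mu> UNIV = n" using range[OF \<mu>] by (simp add: sm_range_def)
    note tight = base_polytope_Int_separation[OF sm[OF \<mu>] sm[OF \<nu>] univ ge]
    show ?thesis
    proof (cases "base_polytope \<mu> \<inter> base_polytope \<nu> = {}")
      case True
      then show ?thesis by simp
    next
      case nonempty: False
      \<comment> \<open>The part \<open>I\<close> of the reversed pair is written \<open>- (- I)\<close> so that the facts on splittings along
        a set and its complement apply to \<open>- I\<close>.\<close>
      let ?\<mu>' = "splitting \<mu> [I, - I]" and ?\<nu>' = "splitting \<nu> [- I, - (- I)]"
      have "bipartition (- I) (- (- I))" using bip by (auto simp: bipartition_iff)
      then have in_C: "?\<mu>' \<in> \<C>" "?\<nu>' \<in> \<C>"
        using closed \<mu> \<nu> bip unfolding closed_family_def bipartition_def by blast+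
      have inter: "base_polytope \<mu> \<inter> base_polytope \<nu> = base_polytope ?\<mu>' \<inter> base_polytope ?\<nu>'"
        using tight(1,2)
        unfolding base_polytope_splitting[OF sm[OF \<mu>] sm[OF in_C(1)]]
          base_polytope_splitting[OF sm[OF \<nu>] sm[OF in_C(2)]]
        by blast
      have "?\<mu>' \<noteq> \<mu> \<or> ?\<nu>' \<noteq> \<nu>" using nonempty tight(3) nontriv by auto
      then have "card (nonseparators ?\<mu>') + card (nonseparators ?\<nu>')
          < card (nonseparators \<mu>) + card (nonseparators \<nu>)"
        using card_nonseparators_splitting[OF sm[OF \<mu>], of I]
          card_nonseparators_splitting[OF sm[OF \<nu>], of "- I"]
        by linarith
      from less.hyps[OF this in_C] show ?thesis
        unfolding inter
        using base_polytope_splitting_face[OF sm[OF \<mu>] sm[OF in_C(1)]]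
          base_polytope_splitting_face[OF sm[OF \<nu>] sm[OF in_C(2)]]
        by (blast intro: face_of_trans)
    qed
  qed
qed

theorem theorem3p6:
  fixes n :: real and \<C> :: "('v::finite set \<Rightarrow> real) set"
  assumes "\<And>\<mu>. \<mu> \<in> \<C> \<Longrightarrow> supermodular \<mu>"
    and "\<And>\<mu>. \<mu> \<in> \<C> \<Longrightarrow> sm_range \<mu> = n"
    and "separated_family n \<C>"
    and "closed_family \<C>"
  shows "tiling (base_polytope ` \<C>) (\<Union>\<mu>\<in>\<C>. base_polytope \<mu>)"
  unfolding tiling_def
  using base_polytope_Int_face[OF assms] by (auto intro: polytope_base_polytope)

end
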